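(* Let $N=\{1,\dots,n\}$. For every coalition game $v:2^N\to\mathbb{R}$ with $v(\emptyset)=0$ and every player $i\in N$, the Shapley value $\phi_i(v)$ equals the value function (average path integral) $\Phi_i$ evaluated at the grand coalition: $$\phi_i(v)=\Phi_i(v,N).$$
   Context: Players: $N=\{1,\dots,n\}$. A coalition game is a function $v:2^N\to\mathbb{R}$ with $v(\emptyset)=0$. Shapley value: for $i\in N$, $$\phi_i(v)=\sum_{S\subseteq N\setminus\{i\}}\frac{|S|!\,(n-|S|-1)!}{n!}\bigl(v(S\cup\{i\})-v(S)\bigr).$$ Coalition game graph: the vertex set is $\mathcal V=2^N$; the forward edges are $\mathcal E=\{(S,S\cup\{i\}) : i\in N,\ S\subseteq N\setminus\{i\}\}$; the reverse edges are $\mathcal E_-=\{(S\cup\{i\},S) : i\in N,\ S\subseteq N\setminus\{i\}\}$; and $\overline{\mathcal E}=\mathcal E\cup\mathcal E_-$. Write $S\sim T$ if $(S,T)\in\overline{\mathcal E}$. Random coalition process: $(X_t)_{t\ge 0}$ is the Markov chain on $\mathcal V$ with $X_0=\emptyset$ and transition probabilities $p_{S,T}=1/n$ if $T\sim S$ and $p_{S,T}=0$ otherwise. For $T\in\mathcal V$, $\tau_T=\min\{t\ge 1 : X_t=T\}$ is the first time $t\geq 1$ at which the process visits $T$. Partial differential: $\partial_i v:\overline{\mathcal E}\to\mathbb{R}$ is defined by $\partial_i v(S,S\cup\{j\})=v(S\cup\{i\})-v(S)$ if $j=i$ and $=0$ if $j\ne i$ (for $S\subseteq N\setminus\{j\}$),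 and $\partial_i v(S\cup\{j\},S)=-\partial_i v(S,S\cup\{j\})$. Value function: for $i\in N$ and $T\subseteq N$, $$\Phi_i(v,T)=\mathbb{E}\Bigl[\sum_{t=1}^{\tau_T}\partial_i v(X_{t-1},X_t)\Bigr].$$ *)

theory Defs
  imports "HOL-Probability.Probability"
begin

definition players :: "nat \<Rightarrow> nat set" where
  "players n = {1..n}"

text \<open>A game is a function on all sets of naturals; only its values on subsets of
  \<open>players n\<close> ever enter the definitions below.\<close>

definition coalition_game :: "(nat set \<Rightarrow> real) \<Rightarrow> bool" where
  "coalition_game v \<longleftrightarrow> v {} = 0"

definition shapley :: "nat \<Rightarrow> nat \<Rightarrow> (nat set \<Rightarrow> real) \<Rightarrow> real" where
  "shapley n i v =
     (\<Sum>S\<in>Pow (players n - {i}).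
        fact (card S) * fact (n - card S - 1) / fact n * (v (S \<union> {i}) - v S))"

definition forward_edges :: "nat \<Rightarrow> (nat set \<times> nat set) set" where
  "forward_edges n = {(S, S \<union> {i}) | S i. i \<in> players n \<and> S \<subseteq> players n - {i}}"

definition reverse_edges :: "nat \<Rightarrow> (nat set \<times> nat set) set" where
  "reverse_edges n = {(S \<union> {i}, S) | S i. i \<in> players n \<and> S \<subseteq> players n - {i}}"

definition edges :: "nat \<Rightarrow> (nat set \<times> nat set) set" where
  "edges n = forward_edges n \<union> reverse_edges n"

text \<open>On a forward edge \<open>(S, S \<union> {j})\<close> the condition \<open>T = S \<union> {i}\<close> says \<open>j = i\<close>;
  see the two lemmas after the definition. Off the edge set the value is set to 0.\<close>

definition partial_diff :: "nat \<Rightarrow> nat \<Rightarrow> (nat set \<Rightarrow> real) \<Rightarrow> nat set \<times> nat set \<Rightarrow> real" where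
  "partial_diff n i v = (\<lambda>(S, T).
     if (S, T) \<in> forward_edges n then (if T = S \<union> {i} then v (S \<union> {i}) - v S else 0)
     else if (S, T) \<in> reverse_edges n then - (if S = T \<union> {i} then v (T \<union> {i}) - v T else 0)
     else 0)"

lemma partial_diff_forward:
  assumes "j \<in> players n" "S \<subseteq> players n - {j}"
  shows "partial_diff n i v (S, S \<union> {j}) = (if j = i then v (S \<union> {i}) - v S else 0)"
proof -
  have "(S, S \<union> {j}) \<in> forward_edges n"
    using assms unfolding forward_edges_def by blast
  moreover have "S \<union> {j} = S \<union> {i} \<longleftrightarrow> j = i"
    using assms by blast
  ultimately show ?thesis
    by (simp add: partial_diff_def)
qed

lemma partial_diff_reverse:
  assumes "j \<in> players n" "S \<subseteq> players n - {j}"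
  shows "partial_diff n i v (S \<union> {j}, S) = - partial_diff n i v (S, S \<union> {j})"
proof -
  have "(S \<union> {j}, S) \<in> reverse_edges n"
    using assms unfolding reverse_edges_def by blast
  moreover have "(S \<union> {j}, S) \<notin> forward_edges n"
    using assms unfolding forward_edges_def by auto
  moreover have "S \<union> {j} = S \<union> {i} \<longleftrightarrow> j = i"
    using assms by blast
  ultimately have "partial_diff n i v (S \<union> {j}, S) = - (if j = i then v (S \<union> {i}) - v S else 0)"
    unfolding partial_diff_def by (simp del: Un_insert_right)
  then show ?thesis
    by (simp only: partial_diff_forward[OF assms])
qed

text \<open>Time-homogeneous Markov chain with state space \<open>V\<close> and transition probabilities \<open>p\<close>,
  on an arbitrary probability space. The Markov property is required only for histories of
  positive probability.\<close>

locale markov_chain = prob_space M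
  for M :: "'w measure" and V :: "'s set" and p :: "'s \<Rightarrow> 's \<Rightarrow> real" and X :: "nat \<Rightarrow> 'w \<Rightarrow> 's" +
  assumes measurable_X: "\<And>t. X t \<in> measurable M (count_space V)"
    and markov_property: "\<And>t s y. y \<in> V \<Longrightarrow> \<P>(\<omega> in M. \<forall>k\<le>t. X k \<omega> = s k) > 0 \<Longrightarrow>
      \<P>(\<omega> in M. X (Suc t) \<omega> = y \<bar> \<forall>k\<le>t. X k \<omega> = s k) = p (s t) y"

definition coalition_trans_prob :: "nat \<Rightarrow> nat set \<Rightarrow> nat set \<Rightarrow> real" where
  "coalition_trans_prob n S T = (if (S, T) \<in> edges n then 1 / real n else 0)"

locale random_coalition_process =
  markov_chain M "Pow (players n)" "coalition_trans_prob n" X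
  for M :: "'w measure" and n :: nat and X :: "nat \<Rightarrow> 'w \<Rightarrow> nat set" +
  assumes start: "AE \<omega> in M. X 0 \<omega> = {}"

text \<open>First visit at a time \<open>t \<ge> 1\<close>; \<open>\<infinity>\<close> if there is none.\<close>

definition first_visit :: "(nat \<Rightarrow> 'w \<Rightarrow> 's) \<Rightarrow> 's \<Rightarrow> 'w \<Rightarrow> enat" where
  "first_visit X T \<omega> = (INF t\<in>{t. 1 \<le> t \<and> X t \<omega> = T}. enat t)"

text \<open>On \<open>first_visit X T \<omega> = \<infinity>\<close> the index set is infinite and the sum is 0 by convention.\<close>

definition path_integral ::
    "nat \<Rightarrow> nat \<Rightarrow> (nat set \<Rightarrow> real) \<Rightarrow> (nat \<Rightarrow> 'w \<Rightarrow> nat set) \<Rightarrow> nat set \<Rightarrow> 'w \<Rightarrow> real" where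
  "path_integral n i v X T \<omega> =
     (\<Sum>t | 1 \<le> t \<and> enat t \<le> first_visit X T \<omega>. partial_diff n i v (X (t - 1) \<omega>, X t \<omega>))"

definition value_function ::
    "'w measure \<Rightarrow> nat \<Rightarrow> (nat \<Rightarrow> 'w \<Rightarrow> nat set) \<Rightarrow> nat \<Rightarrow> (nat set \<Rightarrow> real) \<Rightarrow> nat set \<Rightarrow> real" where
  "value_function M n X i v T = (\<integral>\<omega>. path_integral n i v X T \<omega> \<partial>M)"

end

theory Submission
  imports Defs
begin

text \<open>
  The walk is run from \<open>{}\<close> to \<open>players n\<close>, and a forward edge \<open>(S, S \<union> {i})\<close> contributes
  \<open>v (S \<union> {i}) - v S\<close> times the expected net number of its crossings.  In the language of
  electrical networks this net number is the unit current flowing from \<open>{}\<close> to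
  \<open>players n\<close> through the hypercube.  By symmetry the current spreads evenly over the
  \<open>(n choose k) * (n - k)\<close> edges between levels \<open>k\<close> and \<open>k + 1\<close>, so every one of them carries
  \<open>fact k * fact (n - k - 1) / fact n\<close>, which is the Shapley weight of a coalition of
  size \<open>k\<close>.

  To make this precise, let \<open>G S\<close> be the expected number of times before the visit to
  \<open>players n\<close> at which the walk is at \<open>S\<close>.  Each step uses a given neighbour with probability
  \<open>1 / n\<close>, so the current through \<open>(S, S \<union> {i})\<close> is \<open>(G S - G (S \<union> {i})) / n\<close>.  Summing the
  conjectured currents upwards from the top level gives the candidate \<open>green n (card S)\<close> for
  \<open>G S\<close>.  The candidate and \<open>G\<close> both vanish at \<open>players n\<close> and both satisfy the
  balance equation ``mean of the neighbours, plus one at \<open>{}\<close>'' (lemma \<open>green_equation\<close>), and a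
  maximum principle on the hypercube (lemma \<open>discrete_harmonic_eq_0\<close>) makes them equal
  (lemma \<open>suminf_occupation\<close>).

  The same candidate settles every convergence question.  The partial sums that define \<open>G\<close> are
  obtained by iterating the balance equation from zero, and since \<open>green\<close> is a nonnegative fixed
  point of this monotone iteration, it bounds them all
  (lemma \<open>occupation_partial_sum_le_green\<close>).  Hence the probabilities of not having met
  \<open>players n\<close> by time \<open>t\<close> are summable; Borel--Cantelli then gives a finite hitting time, and
  their summability justifies exchanging expectation and sum in the path integral.
\<close>

section \<open>The random walk on the hypercube\<close>

definition toggle :: "'a \<Rightarrow> 'a set \<Rightarrow> 'a set" where
  "toggle j S = (if j \<in> S then S - {j} else insert j S)"

lemma inj_on_toggle: "inj_on (\<lambda>j. toggle j S) A"
  by (rule inj_onI) (auto simp: toggle_def split: if_splits)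

lemma toggle_subset_iff: "j \<in> A \<Longrightarrow> toggle j S \<subseteq> A \<longleftrightarrow> S \<subseteq> A"
  by (auto simp: toggle_def)

lemma finite_players [simp]: "finite (players n)"
  by (simp add: players_def)

lemma card_players [simp]: "card (players n) = n"
  by (simp add: players_def)

lemma edges_iff_toggle:
  assumes "S \<subseteq> players n"
  shows "(S, T) \<in> edges n \<longleftrightarrow> (\<exists>j\<in>players n. T = toggle j S)"
proof
  assume "(S, T) \<in> edges n"
  then show "\<exists>j\<in>players n. T = toggle j S"
    unfolding edges_def forward_edges_def reverse_edges_def toggle_def by auto
next
  assume "\<exists>j\<in>players n. T = toggle j S"
  then obtain j where j: "j \<in> players n" "T = toggle j S" by blast
  show "(S, T) \<in> edges n"
  proof (cases "j \<in> S")
    case True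
    then have "S = T \<union> {j}" "T \<subseteq> players n - {j}" using j assms by (auto simp: toggle_def)
    with j(1) show ?thesis unfolding edges_def reverse_edges_def by blast
  next
    case False
    then have "T = S \<union> {j}" "S \<subseteq> players n - {j}" using j assms by (auto simp: toggle_def)
    with j(1) show ?thesis unfolding edges_def forward_edges_def by blast
  qed
qed

lemma coalition_trans_prob_commute:
  "coalition_trans_prob n S T = coalition_trans_prob n T S"
proof -
  have "(S, T) \<in> edges n \<longleftrightarrow> (T, S) \<in> edges n"
    unfolding edges_def forward_edges_def reverse_edges_def by blast
  then show ?thesis by (simp add: coalition_trans_prob_def)
qed

text \<open>Distinct players lead to distinct neighbours, so a sum against the transition
  probabilities becomes an average over the player that joins or leaves.\<close>

lemma sum_coalition_trans_prob:
  assumes "S \<subseteq> players n"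
  shows "(\<Sum>T\<in>Pow (players n). coalition_trans_prob n S T * f T)
       = (\<Sum>j\<in>players n. f (toggle j S)) / real n"
proof -
  have "(\<Sum>T\<in>Pow (players n). coalition_trans_prob n S T * f T)
      = (\<Sum>T\<in>(\<lambda>j. toggle j S) ` players n. f T / real n)"
    by (rule sum.mono_neutral_cong_right)
       (use assms toggle_subset_iff[of _ "players n" S] in
         \<open>auto simp: coalition_trans_prob_def edges_iff_toggle\<close>)
  also have "\<dots> = (\<Sum>j\<in>players n. f (toggle j S) / real n)"
    by (simp add: sum.reindex[OF inj_on_toggle])
  finally show ?thesis by (simp add: sum_divide_distrib)
qed

text \<open>Maximum principle: where a harmonic function attains its maximum, all neighbours attain it
  too.  From any maximiser one can therefore add players one at a time until
  \<open>players n\<close> is reached, so the maximum is the boundary value.\<close>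

lemma discrete_harmonic_nonpos:
  fixes d :: "nat set \<Rightarrow> real"
  assumes harmonic: "\<And>T. T \<subset> players n \<Longrightarrow>
      d T = (\<Sum>S\<in>Pow (players n). coalition_trans_prob n T S * d S)"
    and boundary: "d (players n) = 0"
    and T: "T \<subseteq> players n"
  shows "d T \<le> 0"
proof -
  define m where "m = Max (d ` Pow (players n))"
  have d_le: "d S \<le> m" if "S \<subseteq> players n" for S
    unfolding m_def using that by (intro Max_ge) auto
  \<comment> \<open>Climbing the hypercube: the maximum is attained at arbitrarily high levels.\<close>
  have attained: "k \<le> n \<Longrightarrow> \<exists>S\<subseteq>players n. k \<le> card S \<and> d S = m" for k
  proof (induction k)
    case 0
    have "m \<in> d ` Pow (players n)"
      unfolding m_def by (rule Max_in) auto
    then show ?case by auto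
  next
    case (Suc k)
    then obtain S where S: "S \<subseteq> players n" "k \<le> card S" "d S = m" by auto
    show ?case
    proof (cases "S = players n")
      case True
      then show ?thesis using S Suc.prems by auto
    next
      case False
      with S obtain j where j: "j \<in> players n" "j \<notin> S" by blast
      then have n: "n > 0" by (auto simp: players_def)
      have "real n * d S = (\<Sum>j\<in>players n. d (toggle j S))"
        using harmonic[of S] S False n sum_coalition_trans_prob[of S n d]
        by (auto simp: field_simps)
      then have "(\<Sum>j\<in>players n. m - d (toggle j S)) = 0"
        using S by (simp add: sum_subtractf)
      then have "d (toggle j S) = m"
        using sum_nonneg_eq_0_iff[of "players n" "\<lambda>j. m - d (toggle j S)"] d_le S j
        by (auto simp: toggle_subset_iff)
      moreover have "toggle j S = insert j S" "finite S"
        using j S finite_subset[of S "players n"] by (auto simp: toggle_def)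
      ultimately show ?thesis
        using S j by (intro exI[of _ "insert j S"]) auto
    qed
  qed
  from attained[of n] obtain S where "S \<subseteq> players n" "n \<le> card S" "d S = m" by auto
  moreover from this have "S = players n"
    by (intro card_seteq) auto
  ultimately show ?thesis using boundary d_le[OF T] by simp
qed

lemma discrete_harmonic_eq_0:
  fixes d :: "nat set \<Rightarrow> real"
  assumes "\<And>T. T \<subset> players n \<Longrightarrow>
      d T = (\<Sum>S\<in>Pow (players n). coalition_trans_prob n T S * d S)"
    and "d (players n) = 0" and "T \<subseteq> players n"
  shows "d T = 0"
proof (rule antisym)
  show "d T \<le> 0" using assms by (rule discrete_harmonic_nonpos)
  have "- d T \<le> 0"
    by (rule discrete_harmonic_nonpos[where n = n])
       (use assms in \<open>auto simp: sum_negf\<close>)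
  then show "0 \<le> d T" by simp
qed

section \<open>The Green function\<close>

text \<open>The \<open>j\<close>-th summand is \<open>n\<close> times the current in an edge between levels \<open>j\<close> and \<open>j + 1\<close>;
  starting the sum at level \<open>k\<close> makes the function vanish at the absorbing top level \<open>n\<close>.\<close>

definition green :: "nat \<Rightarrow> nat \<Rightarrow> real" where
  "green n k = (\<Sum>j\<in>{k..<n}. real n * fact j * fact (n - j - 1) / fact n)"

lemma green_nonneg: "green n k \<ge> 0"
  unfolding green_def by (intro sum_nonneg) auto

lemma green_top: "green n n = 0"
  by (simp add: green_def)

lemma green_step:
  assumes "k < n"
  shows "green n k = green n (Suc k) + real n * fact k * fact (n - k - 1) / fact n"
  unfolding green_def using assms by (simp add: sum.atLeast_Suc_lessThan)

text \<open>Kirchhoff's current law at a vertex of level \<open>k\<close>: the \<open>k\<close> edges from below bring in as much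
  current as the \<open>n - k\<close> edges to the level above carry away, except at \<open>{}\<close>, where one unit
  is fed in.\<close>

lemma green_balance:
  assumes "k < n"
  shows "real n * green n k = real n * of_bool (k = 0)
           + real k * green n (k - 1) + real (n - k) * green n (Suc k)"
proof (cases k)
  case 0
  have "(fact n :: real) = real n * fact (n - 1)"
    using assms by (subst fact_reduce) auto
  then show ?thesis using assms green_step[of 0 n] 0 by (simp add: field_simps)
next
  case (Suc l)
  have k: "real (n - k) * fact (n - k - 1) = (fact (n - k) :: real)"
    using assms by (subst fact_reduce[of "n - k"]) auto
  have l: "(fact k :: real) = real k * fact l"
    using Suc by simp
  have "green n (k - 1) = green n k + real n * fact l * fact (n - k) / fact n"
    using green_step[of l n] assms Suc by simp
  moreover have "real (n - k) * green n (Suc k)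
      = real (n - k) * green n k - real n * fact k * fact (n - k) / fact n"
    unfolding k[symmetric] green_step[OF assms] by (simp add: algebra_simps)
  ultimately show ?thesis
    using assms Suc unfolding l by (simp add: algebra_simps of_nat_diff)
qed

lemma green_equation:
  assumes "T \<subset> players n"
  shows "green n (card T) = of_bool (T = {})
    + (\<Sum>S\<in>Pow (players n). coalition_trans_prob n T S * green n (card S))"
proof -
  have fin: "finite T" using assms finite_subset[of T "players n"] by auto
  have card: "card T < n"
    using psubset_card_mono[OF finite_players assms] by simp
  have "(\<Sum>j\<in>players n. green n (card (toggle j T)))
      = (\<Sum>j\<in>T. green n (card (toggle j T))) + (\<Sum>j\<in>players n - T. green n (card (toggle j T)))"
    using assms by (subst sum.subset_diff[of T]) (auto simp: add.commute)
  also have "\<dots> = (\<Sum>j\<in>T. green n (card T - 1)) + (\<Sum>j\<in>players n - T. green n (Suc (card T)))"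
    using fin by (intro arg_cong2[of _ _ _ _ "(+)"] sum.cong) (auto simp: toggle_def)
  also have "\<dots> = real (card T) * green n (card T - 1)
                 + real (n - card T) * green n (Suc (card T))"
    using fin assms by (simp add: card_Diff_subset)
  finally have "real n * of_bool (T = {}) + (\<Sum>j\<in>players n. green n (card (toggle j T)))
      = real n * green n (card T)"
    using green_balance[OF card] fin by simp
  then have "real n * green n (card T)
      = real n * of_bool (T = {}) + (\<Sum>j\<in>players n. green n (card (toggle j T)))"
    by simp
  moreover have "(\<Sum>S\<in>Pow (players n). coalition_trans_prob n T S * green n (card S))
      = (\<Sum>j\<in>players n. green n (card (toggle j T))) / real n"
    using assms by (intro sum_coalition_trans_prob) auto
  ultimately have "real n * green n (card T) = real n * (of_bool (T = {})
      + (\<Sum>S\<in>Pow (players n). coalition_trans_prob n T S * green n (card S)))"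
    using card by (simp add: distrib_left)
  then show ?thesis using card by simp
qed

section \<open>Occupation probabilities before the first visit\<close>

lemma (in markov_chain) pred_X [measurable]: "Measurable.pred M (\<lambda>\<omega>. P (X t \<omega>))"
  by (rule measurable_compose[OF measurable_X]) simp

text \<open>When the history has probability zero, both sides vanish; so the multiplicative form
  of the Markov property holds for every history.\<close>

lemma (in markov_chain) prob_history_step:
  assumes "y \<in> V"
  shows "\<P>(\<omega> in M. (\<forall>k\<le>t. X k \<omega> = s k) \<and> X (Suc t) \<omega> = y)
       = \<P>(\<omega> in M. \<forall>k\<le>t. X k \<omega> = s k) * p (s t) y"
proof (cases "\<P>(\<omega> in M. \<forall>k\<le>t. X k \<omega> = s k) > 0")
  case True
  from markov_property[OF assms True] show ?thesis
    using True by (simp add: cond_prob_def field_simps conj_commute)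
next
  case False
  then have 0: "\<P>(\<omega> in M. \<forall>k\<le>t. X k \<omega> = s k) = 0"
    using measure_nonneg[of M] by (simp add: order_less_le)
  have "\<P>(\<omega> in M. (\<forall>k\<le>t. X k \<omega> = s k) \<and> X (Suc t) \<omega> = y) \<le> \<P>(\<omega> in M. \<forall>k\<le>t. X k \<omega> = s k)"
    by (intro finite_measure_mono) auto
  with 0 show ?thesis by (simp add: measure_le_0_iff)
qed

text \<open>The constraints may depend on time, which allows a visit at time \<open>0\<close> to be ignored.  With
  finitely many states, the event is a finite disjoint union of single histories ending in \<open>x\<close>,
  and each of them contributes the same factor \<open>p x y\<close>.\<close>

lemma (in markov_chain) prob_constrained_step:
  assumes V: "finite V" and y: "y \<in> V"
  shows "\<P>(\<omega> in M. ((\<forall>k\<le>t. Q k (X k \<omega>)) \<and> X t \<omega> = x) \<and> X (Suc t) \<omega> = y)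
       = \<P>(\<omega> in M. (\<forall>k\<le>t. Q k (X k \<omega>)) \<and> X t \<omega> = x) * p x y"
proof -
  define H where "H = {s \<in> {..t} \<rightarrow>\<^sub>E V. (\<forall>k\<le>t. Q k (s k)) \<and> s t = x}"
  have H: "finite H"
    unfolding H_def using V by (intro finite_subset[OF _ finite_PiE[of "{..t}" "\<lambda>_. V"]]) auto
  have in_V: "X k \<omega> \<in> V" if "\<omega> \<in> space M" for k \<omega>
    using measurable_space[OF measurable_X that] by simp
  have disj: "disjoint_family_on (\<lambda>s. {\<omega> \<in> space M. (\<forall>k\<le>t. X k \<omega> = s k) \<and> R \<omega>}) H" for R
    unfolding disjoint_family_on_def
  proof (intro ballI impI)
    fix s s' assume ss': "s \<in> H" "s' \<in> H" "s \<noteq> s'"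
    have "\<exists>k\<le>t. s k \<noteq> s' k"
    proof (rule ccontr)
      assume "\<not> (\<exists>k\<le>t. s k \<noteq> s' k)"
      then have "s = s'"
        using ss' unfolding H_def by (intro PiE_ext[of s "{..t}" "\<lambda>_. V" s']) auto
      with ss' show False by simp
    qed
    then show "{\<omega> \<in> space M. (\<forall>k\<le>t. X k \<omega> = s k) \<and> R \<omega>}
        \<inter> {\<omega> \<in> space M. (\<forall>k\<le>t. X k \<omega> = s' k) \<and> R \<omega>} = {}" by auto
  qed
  have split: "\<P>(\<omega> in M. ((\<forall>k\<le>t. Q k (X k \<omega>)) \<and> X t \<omega> = x) \<and> R \<omega>)
      = (\<Sum>s\<in>H. \<P>(\<omega> in M. (\<forall>k\<le>t. X k \<omega> = s k) \<and> R \<omega>))"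
    if [measurable]: "Measurable.pred M R" for R
  proof -
    have "{\<omega> \<in> space M. ((\<forall>k\<le>t. Q k (X k \<omega>)) \<and> X t \<omega> = x) \<and> R \<omega>}
        = (\<Union>s\<in>H. {\<omega> \<in> space M. (\<forall>k\<le>t. X k \<omega> = s k) \<and> R \<omega>})" (is "?L = ?U")
    proof
      show "?L \<subseteq> ?U"
      proof
        fix \<omega> assume \<omega>: "\<omega> \<in> ?L"
        then have "restrict (\<lambda>k. X k \<omega>) {..t} \<in> H"
          unfolding H_def using in_V by auto
        with \<omega> show "\<omega> \<in> ?U" by (intro UN_I[of "restrict (\<lambda>k. X k \<omega>) {..t}"]) auto
      qed
    qed (auto simp: H_def)
    then show ?thesis
      using H disj[of R] by (subst measure_finite_Union[symmetric]) auto
  qed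
  have "\<P>(\<omega> in M. ((\<forall>k\<le>t. Q k (X k \<omega>)) \<and> X t \<omega> = x) \<and> X (Suc t) \<omega> = y)
      = (\<Sum>s\<in>H. \<P>(\<omega> in M. \<forall>k\<le>t. X k \<omega> = s k) * p x y)"
    by (subst split) (auto simp: prob_history_step[OF y] H_def intro!: sum.cong)
  also have "\<dots> = \<P>(\<omega> in M. (\<forall>k\<le>t. Q k (X k \<omega>)) \<and> X t \<omega> = x) * p x y"
    using split[of "\<lambda>_. True"] by (simp add: sum_distrib_right)
  finally show ?thesis .
qed

context random_coalition_process
begin

text \<open>Time \<open>0\<close> is excluded to match first visits, which are counted from time \<open>1\<close>.  This
  makes the identities for single paths below hold whatever the initial state of the path is.\<close>

definition unvisited :: "nat \<Rightarrow> 'w \<Rightarrow> bool" where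
  "unvisited t \<omega> \<longleftrightarrow> (\<forall>k\<le>t. 1 \<le> k \<longrightarrow> X k \<omega> \<noteq> players n)"

lemma pred_unvisited [measurable]: "Measurable.pred M (unvisited t)"
  unfolding unvisited_def[abs_def] by measurable

text \<open>The transition kernel killed at \<open>players n\<close> propagates these numbers, and their sum over
  \<open>t\<close> is the expected number of stays at \<open>S\<close> before the visit.\<close>

definition occupation :: "nat \<Rightarrow> nat set \<Rightarrow> real" where
  "occupation t S = \<P>(\<omega> in M. unvisited t \<omega> \<and> X t \<omega> = S)"

lemma X_subset_players: "\<omega> \<in> space M \<Longrightarrow> X t \<omega> \<subseteq> players n"
  using measurable_space[OF measurable_X, of \<omega> t] by simp

lemma occupation_nonneg: "occupation t S \<ge> 0"
  by (simp add: occupation_def)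

lemma occupation_0: "occupation 0 T = of_bool (T = {})"
proof -
  have "AE \<omega> in M. unvisited 0 \<omega> \<and> X 0 \<omega> = T \<longleftrightarrow> T = {}"
    using start by (auto simp: unvisited_def)
  then have "occupation 0 T = \<P>(\<omega> in M. T = {})"
    unfolding occupation_def by (intro finite_measure_eq_AE) auto
  then show ?thesis by (simp add: prob_space)
qed

lemma occupation_players:
  assumes "n > 0"
  shows "occupation t (players n) = 0"
proof (cases t)
  case 0
  have "players n \<noteq> {}" using assms by (auto simp: players_def)
  with 0 show ?thesis by (simp add: occupation_0)
next
  case (Suc s)
  then have "{\<omega> \<in> space M. unvisited t \<omega> \<and> X t \<omega> = players n} = {}"
    by (auto simp: unvisited_def)
  then show ?thesis unfolding occupation_def by (simp only: measure_empty)
qed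

lemma prob_transition:
  assumes "T \<subseteq> players n"
  shows "\<P>(\<omega> in M. (unvisited t \<omega> \<and> X t \<omega> = S) \<and> X (Suc t) \<omega> = T)
    = occupation t S * coalition_trans_prob n S T"
  unfolding occupation_def unvisited_def
  by (rule prob_constrained_step[where Q = "\<lambda>k S. 1 \<le> k \<longrightarrow> S \<noteq> players n"])
     (use assms in auto)

text \<open>One step of the forward equation.  The transition matrix is symmetric, which allows it to be
  written with the arguments exchanged, as in the harmonicity condition.\<close>

lemma occupation_Suc:
  assumes "T \<subset> players n"
  shows "occupation (Suc t) T
    = (\<Sum>S\<in>Pow (players n). coalition_trans_prob n T S * occupation t S)"
proof -
  have "{\<omega> \<in> space M. unvisited (Suc t) \<omega> \<and> X (Suc t) \<omega> = T}
      = (\<Union>S\<in>Pow (players n).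
          {\<omega> \<in> space M. (unvisited t \<omega> \<and> X t \<omega> = S) \<and> X (Suc t) \<omega> = T})"
    using assms X_subset_players by (auto simp: unvisited_def le_Suc_eq)
  then have "occupation (Suc t) T = (\<Sum>S\<in>Pow (players n).
      \<P>(\<omega> in M. (unvisited t \<omega> \<and> X t \<omega> = S) \<and> X (Suc t) \<omega> = T))"
    unfolding occupation_def
    by (subst measure_finite_Union[symmetric]) (auto simp: disjoint_family_on_def)
  also have "\<dots> = (\<Sum>S\<in>Pow (players n). coalition_trans_prob n T S * occupation t S)"
    using assms
    by (intro sum.cong refl) (simp only: prob_transition[OF psubset_imp_subset]
      coalition_trans_prob_commute[of n T] mult.commute)
  finally show ?thesis .
qed

lemma occupation_partial_sum:
  assumes "T \<subset> players n"
  shows "(\<Sum>s<Suc t. occupation s T) = of_bool (T = {})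
    + (\<Sum>S\<in>Pow (players n). coalition_trans_prob n T S * (\<Sum>s<t. occupation s S))"
  unfolding sum.lessThan_Suc_shift occupation_0 occupation_Suc[OF assms] sum_distrib_left
  by (subst sum.swap) (rule refl)

text \<open>The partial sums iterate the balance equation starting from \<open>0 \<le> green\<close>.  The right-hand
  side of that equation is monotone and has \<open>green\<close> as a fixed point, so they never exceed it.\<close>

lemma occupation_partial_sum_le_green:
  assumes "n > 0" "T \<subseteq> players n"
  shows "(\<Sum>s<t. occupation s T) \<le> green n (card T)"
  using assms(2)
proof (induction t arbitrary: T)
  case 0
  then show ?case by (simp add: green_nonneg)
next
  case (Suc t)
  show ?case
  proof (cases "T = players n")
    case True
    then show ?thesis by (simp add: green_nonneg occupation_players assms(1))
  next
    case False
    with Suc.prems have T: "T \<subset> players n" by auto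
    show ?thesis
      unfolding occupation_partial_sum[OF T] green_equation[OF T]
      by (intro add_left_mono sum_mono mult_left_mono Suc.IH)
         (auto simp: coalition_trans_prob_def)
  qed
qed

lemma summable_occupation:
  assumes "n > 0" "T \<subseteq> players n"
  shows "summable (\<lambda>t. occupation t T)"
  by (rule bounded_imp_summable[where B = "green n (card T)"])
     (use occupation_partial_sum_le_green[OF assms, of "Suc _"] in
       \<open>auto simp: occupation_nonneg lessThan_Suc_atMost\<close>)

text \<open>Letting \<open>t\<close> tend to infinity in the forward equation shows that the total occupation solves the
  same boundary value problem as \<open>green\<close>; their difference is harmonic and vanishes at the
  boundary.\<close>

lemma suminf_occupation:
  assumes "n > 0" "T \<subseteq> players n"
  shows "(\<Sum>t. occupation t T) = green n (card T)"
proof -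
  define d where "d = (\<lambda>T. (\<Sum>t. occupation t T) - green n (card T))"
  have "d T = (\<Sum>S\<in>Pow (players n). coalition_trans_prob n T S * d S)"
    if T: "T \<subset> players n" for T
  proof -
    have "(\<Sum>t. occupation t T) = occupation 0 T + (\<Sum>t. occupation (Suc t) T)"
      using suminf_split_head[OF summable_occupation[OF assms(1)], of T] T by auto
    also have "(\<Sum>t. occupation (Suc t) T)
        = (\<Sum>S\<in>Pow (players n). \<Sum>t. coalition_trans_prob n T S * occupation t S)"
      unfolding occupation_Suc[OF T]
      by (rule suminf_sum) (auto intro!: summable_mult summable_occupation assms(1))
    also have "\<dots> = (\<Sum>S\<in>Pow (players n). coalition_trans_prob n T S * (\<Sum>t. occupation t S))"
      by (intro sum.cong suminf_mult summable_occupation assms(1)) auto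
    finally show ?thesis
      unfolding d_def green_equation[OF T]
      by (simp add: occupation_0 right_diff_distrib sum_subtractf)
  qed
  moreover have "d (players n) = 0" by (simp add: d_def green_top occupation_players assms(1))
  ultimately have "d T = 0" using assms(2) by (rule discrete_harmonic_eq_0)
  then show ?thesis by (simp add: d_def)
qed

lemma summable_prob_not_yet_visited:
  assumes "n > 0"
  shows "summable (\<lambda>t. \<P>(\<omega> in M. unvisited t \<omega>))"
proof -
  have "{\<omega> \<in> space M. unvisited t \<omega>}
      = (\<Union>S\<in>Pow (players n). {\<omega> \<in> space M. unvisited t \<omega> \<and> X t \<omega> = S})" for t
    using X_subset_players by auto
  then have "\<P>(\<omega> in M. unvisited t \<omega>) = (\<Sum>S\<in>Pow (players n). occupation t S)" for t
    unfolding occupation_def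
    by (subst measure_finite_Union[symmetric]) (auto simp: disjoint_family_on_def)
  then show ?thesis
    using assms by (auto intro!: summable_sum summable_occupation)
qed

lemma AE_eventually_visited:
  assumes "n > 0"
  shows "AE \<omega> in M. \<exists>m\<ge>1. X m \<omega> = players n"
proof -
  have "AE \<omega> in M. eventually (\<lambda>t. \<omega> \<in> space M - {\<omega> \<in> space M. unvisited t \<omega>}) sequentially"
    using summable_prob_not_yet_visited[OF assms] by (intro borel_cantelli_AE1) (auto simp: emeasure_eq_measure)
  then show ?thesis
    by eventually_elim (auto simp: eventually_sequentially unvisited_def)
qed

section \<open>The expected path integral\<close>

text \<open>Setting the increments after the first visit to zero turns the sum up to a random time into a
  series with deterministic index set.\<close>

definition stopped_increment ::
    "nat \<Rightarrow> (nat set \<Rightarrow> real) \<Rightarrow> nat \<Rightarrow> 'w \<Rightarrow> real" where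
  "stopped_increment i v t \<omega> =
     (if unvisited t \<omega> then partial_diff n i v (X t \<omega>, X (Suc t) \<omega>) else 0)"

text \<open>The increment takes finitely many values; this expansion as a simple function gives both its
  integrability and its expectation.\<close>

lemma stopped_increment_eq:
  assumes "\<omega> \<in> space M"
  shows "stopped_increment i v t \<omega> =
    (\<Sum>S\<in>Pow (players n). \<Sum>T\<in>Pow (players n). partial_diff n i v (S, T) *
      indicator {\<omega> \<in> space M. (unvisited t \<omega> \<and> X t \<omega> = S) \<and> X (Suc t) \<omega> = T} \<omega>)"
proof -
  have "stopped_increment i v t \<omega> =
    (\<Sum>S\<in>Pow (players n). \<Sum>T\<in>Pow (players n).
       if X t \<omega> = S then if X (Suc t) \<omega> = T then stopped_increment i v t \<omega> else 0 else 0)"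
    using X_subset_players[OF assms]
    by (simp add: sum.If_cases if_distrib[of "sum _"] cong: if_cong)
  also have "\<dots> = (\<Sum>S\<in>Pow (players n). \<Sum>T\<in>Pow (players n). partial_diff n i v (S, T) *
      indicator {\<omega> \<in> space M. (unvisited t \<omega> \<and> X t \<omega> = S) \<and> X (Suc t) \<omega> = T} \<omega>)"
    using assms by (intro sum.cong) (auto simp: stopped_increment_def)
  finally show ?thesis .
qed

lemma integrable_stopped_increment: "integrable M (stopped_increment i v t)"
  by (subst Bochner_Integration.integrable_cong[OF refl stopped_increment_eq], assumption)
     (intro Bochner_Integration.integrable_sum integrable_mult_right
        integrable_real_indicator; simp add: emeasure_eq_measure)

lemma integral_stopped_increment:
  "(\<integral>\<omega>. stopped_increment i v t \<omega> \<partial>M) = (\<Sum>S\<in>Pow (players n). occupation t S *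
      (\<Sum>T\<in>Pow (players n). coalition_trans_prob n S T * partial_diff n i v (S, T)))"
proof -
  have "(\<integral>\<omega>. stopped_increment i v t \<omega> \<partial>M)
    = (\<Sum>S\<in>Pow (players n). \<Sum>T\<in>Pow (players n). partial_diff n i v (S, T) *
        \<P>(\<omega> in M. (unvisited t \<omega> \<and> X t \<omega> = S) \<and> X (Suc t) \<omega> = T))"
    by (subst Bochner_Integration.integral_cong[OF refl stopped_increment_eq], assumption,
        subst Bochner_Integration.integral_sum,
        (intro Bochner_Integration.integrable_sum; simp add: emeasure_eq_measure),
        intro sum.cong refl, subst Bochner_Integration.integral_sum)
       (simp_all add: emeasure_eq_measure)
  also have "\<dots> = (\<Sum>S\<in>Pow (players n). occupation t S *
      (\<Sum>T\<in>Pow (players n). coalition_trans_prob n S T * partial_diff n i v (S, T)))"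
    unfolding sum_distrib_left
    by (intro sum.cong refl) (simp only: prob_transition[OF PowD] mult_ac)
  finally show ?thesis .
qed

text \<open>The summand at time \<open>t \<ge> 1\<close> of the path integral is the increment with index \<open>t - 1\<close>, and
  \<open>t\<close> is at most the first visiting time exactly when the target is unvisited at time
  \<open>t - 1\<close>.\<close>

lemma path_integral_sums:
  assumes "m \<ge> 1" "X m \<omega> = players n"
  shows "(\<lambda>t. stopped_increment i v t \<omega>) sums path_integral n i v X (players n) \<omega>"
proof -
  define A where "A = {t. unvisited t \<omega>}"
  have "A \<subseteq> {..<m}" using assms by (auto simp: A_def unvisited_def not_le[symmetric])
  then have "finite A" by (rule finite_subset) simp
  have "{t. 1 \<le> t \<and> enat t \<le> first_visit X (players n) \<omega>} = Suc ` A"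
  proof (rule set_eqI)
    fix t
    have "enat t \<le> first_visit X (players n) \<omega> \<longleftrightarrow> (\<forall>k. 1 \<le> k \<longrightarrow> X k \<omega> = players n \<longrightarrow> t \<le> k)"
      unfolding first_visit_def by (auto simp: le_INF_iff)
    also have "\<dots> \<longleftrightarrow> (\<forall>k<t. 1 \<le> k \<longrightarrow> X k \<omega> \<noteq> players n)"
      by (auto simp: not_le[symmetric])
    finally show "t \<in> {t. 1 \<le> t \<and> enat t \<le> first_visit X (players n) \<omega>} \<longleftrightarrow> t \<in> Suc ` A"
      by (cases t) (auto simp: A_def unvisited_def less_Suc_eq_le)
  qed
  then have "path_integral n i v X (players n) \<omega> = (\<Sum>t\<in>A. stopped_increment i v t \<omega>)"
    unfolding path_integral_def
    by (simp add: sum.reindex) (auto simp: A_def stopped_increment_def intro!: sum.cong)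
  then show ?thesis
    using sums_finite[OF \<open>finite A\<close>, of "\<lambda>t. stopped_increment i v t \<omega>"]
    by (simp add: A_def stopped_increment_def)
qed

text \<open>An everywhere valid formula, including the null set of paths that never arrive, is needed for
  measurability because \<open>M\<close> need not be complete.\<close>

lemma path_integral_eq_suminf:
  "path_integral n i v X (players n) \<omega>
   = (if \<exists>m\<ge>1. X m \<omega> = players n then \<Sum>t. stopped_increment i v t \<omega> else 0)"
proof (cases "\<exists>m\<ge>1. X m \<omega> = players n")
  case True
  then show ?thesis using path_integral_sums[of _ \<omega> i v] by (auto simp: sums_iff)
next
  case False
  then have "{t. 1 \<le> t \<and> X t \<omega> = players n} = {}" by auto
  then have "first_visit X (players n) \<omega> = \<infinity>"
    unfolding first_visit_def by (simp only:) (simp add: top_enat_def)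
  moreover have "infinite {t::nat. 1 \<le> t}"
    using infinite_Ici[of "1::nat"] by (simp add: atLeast_def)
  ultimately have "path_integral n i v X (players n) \<omega> = 0"
    by (simp add: path_integral_def)
  then show ?thesis using False by (simp only: if_False)
qed

lemma path_integral_measurable:
  "path_integral n i v X (players n) \<in> borel_measurable M"
proof -
  have [measurable]: "stopped_increment i v t \<in> borel_measurable M" for t
    using integrable_stopped_increment by (rule borel_measurable_integrable)
  show ?thesis
    unfolding path_integral_eq_suminf[abs_def] by measurable
qed

end

text \<open>On a reverse edge the sign change in the partial differential exchanges the end points, so
  forward and reverse edges are covered by the same expression.\<close>

lemma partial_diff_toggle:
  assumes "j \<in> players n" "S \<subseteq> players n"
  shows "partial_diff n i v (S, toggle j S) = (if j = i then v (toggle i S) - v S else 0)"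
proof (cases "j \<in> S")
  case True
  then have "S = toggle j S \<union> {j}" "toggle j S \<subseteq> players n - {j}"
    using assms by (auto simp: toggle_def)
  then show ?thesis
    using partial_diff_reverse[OF assms(1), of "toggle j S" i v]
      partial_diff_forward[OF assms(1), of "toggle j S" i v] by auto
next
  case False
  then have "toggle j S = S \<union> {j}" "S \<subseteq> players n - {j}"
    using assms by (auto simp: toggle_def)
  then show ?thesis
    using partial_diff_forward[OF assms(1), of S i v] by auto
qed

lemma expected_partial_diff:
  assumes "i \<in> players n" "S \<subseteq> players n"
  shows "(\<Sum>T\<in>Pow (players n). coalition_trans_prob n S T * partial_diff n i v (S, T))
       = (v (toggle i S) - v S) / real n"
proof -
  have "(\<Sum>T\<in>Pow (players n). coalition_trans_prob n S T * partial_diff n i v (S, T))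
      = (\<Sum>j\<in>players n. if j = i then v (toggle i S) - v S else 0) / real n"
    using assms by (simp add: sum_coalition_trans_prob partial_diff_toggle)
  then show ?thesis using assms by simp
qed

text \<open>The terms for \<open>S\<close> and \<open>insert i S\<close> belong to the two directions of one edge.  Together they
  leave the difference of \<open>green\<close> at consecutive levels, which is \<open>n\<close> times the Shapley
  weight.\<close>

lemma shapley_eq_green_sum:
  assumes "i \<in> players n"
  shows "shapley n i v
    = (\<Sum>S\<in>Pow (players n). green n (card S) * ((v (toggle i S) - v S) / real n))"
proof -
  let ?N = "players n" and ?f = "\<lambda>S. green n (card S) * ((v (toggle i S) - v S) / real n)"
  have fin: "finite S" if "S \<subseteq> ?N - {i}" for S
    using that finite_subset[of S "?N"] by auto
  have "Pow ?N = Pow (insert i (?N - {i}))" using assms by (simp add: insert_absorb)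
  also have "\<dots> = Pow (?N - {i}) \<union> insert i ` Pow (?N - {i})" by (rule Pow_insert)
  finally have "sum ?f (Pow ?N) = sum ?f (Pow (?N - {i})) + sum ?f (insert i ` Pow (?N - {i}))"
    by (simp only:) (rule sum.union_disjoint, auto)
  also have "sum ?f (insert i ` Pow (?N - {i})) = (\<Sum>S\<in>Pow (?N - {i}). ?f (insert i S))"
    by (subst sum.reindex) (auto simp: inj_on_def)
  also have "sum ?f (Pow (?N - {i})) + (\<Sum>S\<in>Pow (?N - {i}). ?f (insert i S))
      = (\<Sum>S\<in>Pow (?N - {i}). ?f S + ?f (insert i S))"
    by (rule sum.distrib[symmetric])
  also have "\<dots> = shapley n i v"
    unfolding shapley_def
  proof (rule sum.cong[OF refl])
    fix S assume "S \<in> Pow (?N - {i})"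
    then have S: "S \<subseteq> ?N - {i}" "i \<notin> S" by auto
    have "card S < card ?N" by (rule psubset_card_mono) (use S assms in auto)
    then have card: "card S < n" by simp
    have "insert i S - {i} = S" using S by auto
    then have "toggle i S = insert i S" "toggle i (insert i S) = S" "card (insert i S) = Suc (card S)"
      using S fin[OF S(1)] by (auto simp: toggle_def)
    then show "?f S + ?f (insert i S)
        = fact (card S) * fact (n - card S - 1) / fact n * (v (S \<union> {i}) - v S)"
      using card by (simp add: green_step[OF card] field_simps)
  qed
  finally show ?thesis by simp
qed

theorem theorem3p1:
  fixes M :: "'w measure" and n i :: nat and X :: "nat \<Rightarrow> 'w \<Rightarrow> nat set"
    and v :: "nat set \<Rightarrow> real"
  assumes "random_coalition_process M n X"
    and "coalition_game v"
    and "i \<in> players n"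
  shows "(AE \<omega> in M. first_visit X (players n) \<omega> < \<infinity>)
    \<and> integrable M (path_integral n i v X (players n))
    \<and> shapley n i v = value_function M n X i v (players n)"
proof -
  interpret random_coalition_process M n X by fact
  have n: "n > 0" using assms(3) by (auto simp: players_def)
  define F where "F = stopped_increment i v"
  \<comment> \<open>A crude bound for a single increment: the total variation of the differential.\<close>
  define C where "C = (\<Sum>e\<in>Pow (players n) \<times> Pow (players n). \<bar>partial_diff n i v e\<bar>)"
  have finite_visit: "AE \<omega> in M. \<exists>m\<ge>1. X m \<omega> = players n"
    by (rule AE_eventually_visited[OF n])
  have sums: "AE \<omega> in M. (\<lambda>t. F t \<omega>) sums path_integral n i v X (players n) \<omega>"
    using finite_visit unfolding F_def
    by eventually_elim (auto intro: path_integral_sums)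
  have abs_sums: "AE \<omega> in M. summable (\<lambda>t. norm (F t \<omega>))"
    using finite_visit
  proof eventually_elim
    case (elim \<omega>)
    then obtain m where m: "m \<ge> 1" "X m \<omega> = players n" by blast
    show ?case
      by (rule summable_finite[of "{..<m}"]) (use m in \<open>auto simp: F_def stopped_increment_def unvisited_def not_less\<close>)
  qed
  have bound: "norm (F t \<omega>) \<le> C * indicator {\<omega> \<in> space M. unvisited t \<omega>} \<omega>"
    if "\<omega> \<in> space M" for t \<omega>
  proof -
    have "\<bar>partial_diff n i v (X t \<omega>, X (Suc t) \<omega>)\<bar> \<le> C"
      unfolding C_def using X_subset_players[OF that] by (intro member_le_sum) auto
    then show ?thesis using that by (auto simp: F_def stopped_increment_def)
  qed
  have "(\<integral>\<omega>. norm (F t \<omega>) \<partial>M) \<le> C * \<P>(\<omega> in M. unvisited t \<omega>)" for t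
  proof -
    have "(\<integral>\<omega>. norm (F t \<omega>) \<partial>M)
        \<le> (\<integral>\<omega>. C * indicator {\<omega> \<in> space M. unvisited t \<omega>} \<omega> \<partial>M)"
      using bound by (intro integral_mono integrable_norm)
        (auto simp: F_def integrable_stopped_increment emeasure_eq_measure)
    then show ?thesis by simp
  qed
  then have norm_sums: "summable (\<lambda>t. \<integral>\<omega>. norm (F t \<omega>) \<partial>M)"
    by (intro summable_comparison_test'[OF
          summable_mult[OF summable_prob_not_yet_visited[OF n], of C], of 0]) auto
  have int: "integrable M (F t)" for t
    unfolding F_def by (rule integrable_stopped_increment)
  have meas: "path_integral n i v X (players n) \<in> borel_measurable M"
    by (rule path_integral_measurable)
  have eq: "AE \<omega> in M. (\<Sum>t. F t \<omega>) = path_integral n i v X (players n) \<omega>"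
    using sums by eventually_elim (rule sums_unique[symmetric])
  have "(\<integral>\<omega>. path_integral n i v X (players n) \<omega> \<partial>M) = (\<integral>\<omega>. (\<Sum>t. F t \<omega>) \<partial>M)"
    using eq meas int by (intro integral_cong_AE) auto
  also have "\<dots> = (\<Sum>t. \<integral>\<omega>. F t \<omega> \<partial>M)"
    by (rule integral_suminf[OF int abs_sums norm_sums])
  also have "\<dots> = (\<Sum>t. \<Sum>S\<in>Pow (players n). occupation t S * ((v (toggle i S) - v S) / real n))"
    unfolding F_def using assms(3)
    by (intro arg_cong[of _ _ suminf] ext)
       (auto simp: integral_stopped_increment expected_partial_diff intro!: sum.cong)
  also have "\<dots> = (\<Sum>S\<in>Pow (players n). \<Sum>t. occupation t S * ((v (toggle i S) - v S) / real n))"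
    by (intro suminf_sum summable_mult2 summable_occupation n) auto
  also have "\<dots> = (\<Sum>S\<in>Pow (players n). green n (card S) * ((v (toggle i S) - v S) / real n))"
    using n by (intro sum.cong refl, subst suminf_mult2[symmetric])
      (auto simp: summable_occupation suminf_occupation)
  also have "\<dots> = shapley n i v"
    by (rule shapley_eq_green_sum[OF assms(3), symmetric])
  finally have "shapley n i v = value_function M n X i v (players n)"
    by (simp add: value_function_def)
  moreover have "integrable M (path_integral n i v X (players n))"
    using integrable_suminf[OF int abs_sums norm_sums] eq meas int
    by (subst integrable_cong_AE[symmetric, where f = "\<lambda>\<omega>. \<Sum>t. F t \<omega>"]) auto
  moreover have "AE \<omega> in M. first_visit X (players n) \<omega> < \<infinity>"
    using finite_visit 
  proof eventually_elim
    case (elim \<omega>)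
    then obtain m where "1 \<le> m" "X m \<omega> = players n" by blast
    then have "first_visit X (players n) \<omega> \<le> enat m"
      unfolding first_visit_def by (intro INF_lower) auto
    then show ?case by (rule order.strict_trans1) simp
  qed
  ultimately show ?thesis by blast
qed

end
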